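(* Let $R=(R,\cdot,(P_\omega)_{\omega\in S},\theta)$ and $V=(V,\cdot_V,(P_{\omega,V})_{\omega\in S},\theta_V)$ be two Rota-Baxter family Hom-associative algebras of weight $\lambda$, let $E$ be a vector space with $E=R+V$ and $R\cap V=\{0\}$, and let $\rho:E\to R$, $\rho(a+x)=a$ ($a\in R$, $x\in V$), be the retraction associated to $V$. Suppose that $E=(E,\cdot_E,(P_{\omega,E})_{\omega\in S},\theta_E)$ is such that $R\subset E$ is an extension of Rota-Baxter family Hom-associative algebras. Then the following are equivalent: (1) The Rota-Baxter family Hom-associative algebra $E$ factorizes through $R$ and $V$. (2) The unified product corresponding to the Rota-Baxter family Hom extending structure $\Omega(R,V)=\Upsilon_1(E)$ is a bicrossed product $R\bowtie V$.
   Context: Fix a field $\mathbf{k}$, a semigroup $S$ and $\lambda\in\mathbf{k}$. All vector spaces and (bi)linear maps are over $\mathbf{k}$; families are indexed by $\omega\in S$. A Rota-Baxter family Hom-associative algebra (of weight $\lambda$) is a 4-tuple $(R,\cdot,(P_\omega)_{\omega\in S},\theta)$, with $R$ a vector space, $\cdot:R\times R\to R$ bilinear, $P_\omega:R\to R$ ($\omega\in S$) and $\theta:R\to R$ linear, such that for all $x,y,z\in R$ and $\omega,\alpha,\beta\in S$: $\theta(x)\cdot(y\cdot z)=(x\cdot y)\cdot\theta(z)$; $P_\alpha(x)\cdot P_\beta(y)=P_{\alpha\beta}(P_\alpha(x)\cdot y+x\cdot P_\beta(y)+\lambda\,x\cdot y)$; $P_\omega(\theta(x))=\theta(P_\omega(x))$.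 A subalgebra of $E$ is a subspace with Rota-Baxter family Hom-associative structure given by restricting $\cdot_E,P_{\omega,E},\theta_E$; $R\subset E$ is an extension if $R$ (with its given structure) is a subalgebra of $E$. $E$ factorizes through $R$ and $V$ if $E$ contains $R$ and $V$ (with their given structures) as subalgebras with $E=R+V$, $R\cap V=\{0\}$. Extending datum of $R$ through a vector space $W$: a system $\Omega(R,W)=(\triangleright,\triangleleft,\rightharpoonup,\leftharpoonup,f,\cdot_W,(Q_\omega),(P_{\omega,W}),\eta,\theta_W)$ of bilinear maps $\triangleright:R\times W\to W$, $\triangleleft:W\times R\to W$, $\rightharpoonup:W\times R\to R$, $\leftharpoonup:R\times W\to R$, $f:W\times W\to R$, $\cdot_W:W\times W\to W$ and linear maps $Q_\omega:W\to R$, $P_{\omega,W}:W\to W$, $\eta:W\to R$, $\theta_W:W\to W$. Its associated object is $R\times W$ with $(a,x)\,\bar\cdot\,(b,y)=(ab+a\leftharpoonup y+x\rightharpoonup b+f(x,y),\ a\triangleright y+x\triangleleft b+x\cdot_W y)$, $\bar P_\omega(a,x)=(P_\omega(a)+Q_\omega(x),P_{\omega,W}(x))$, $\bar\theta(a,x)=(\theta(a)+\eta(x),\theta_W(x))$. The datum is a Rota-Baxter family Hom extending structure, and $R\natural W=(R\times W,\bar\cdot,(\bar P_\omega),\bar\theta)$ is the corresponding unified product, if the latter is a Rota-Baxter family Hom-associative algebra of weight $\lambda$. For Rota-Baxter family Hom-associative algebras $R$ and $V$, a unified product coming from an extending structure of $R$ through $V$ is called a bicrossed product $R\bowtie V$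 if in the extending structure the components $f$, $Q_\omega$ ($\omega\in S$), $\eta$ are all zero and the components $\cdot_V$, $P_{\omega,V}$, $\theta_V$ are the operations of the given algebra $V$. The extending structure $\Upsilon_1(E)$ (relative to $\rho$) is the system on the underlying space of $V$ whose components are, for $a\in R$, $x,y\in V$: $a\triangleright x=a\cdot_E x-\rho(a\cdot_E x)$; $x\triangleleft a=x\cdot_E a-\rho(x\cdot_E a)$; $a\leftharpoonup x=\rho(a\cdot_E x)$; $x\rightharpoonup a=\rho(x\cdot_E a)$; $f(x,y)=\rho(x\cdot_E y)$; product component $(x,y)\mapsto x\cdot_E y-\rho(x\cdot_E y)$; $Q_\omega(x)=\rho(P_{\omega,E}(x))$; Rota-Baxter components $x\mapsto P_{\omega,E}(x)-\rho(P_{\omega,E}(x))$; $\eta(x)=\rho(\theta_E(x))$; twisting component $x\mapsto\theta_E(x)-\rho(\theta_E(x))$. *)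

theory Defs
  imports "HOL-Analysis.Product_Vector"
begin

text \<open>Vector spaces are subspaces of an ambient type equipped with a scalar multiplication, as
  in \<^locale>\<open>vector_space\<close>. Maps are total functions on the ambient types; only their values on
  the carriers are relevant.\<close>

definition linear_on ::
    "('k \<Rightarrow> 'a \<Rightarrow> 'a) \<Rightarrow> ('k \<Rightarrow> 'b \<Rightarrow> 'b) \<Rightarrow> 'a::plus set \<Rightarrow> 'b::plus set \<Rightarrow> ('a \<Rightarrow> 'b) \<Rightarrow> bool"
  where "linear_on s1 s2 A B f \<longleftrightarrow>
    (\<forall>x\<in>A. f x \<in> B) \<and>
    (\<forall>x\<in>A. \<forall>y\<in>A. f (x + y) = f x + f y) \<and>
    (\<forall>c. \<forall>x\<in>A. f (s1 c x) = s2 c (f x))"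

definition bilinear_on ::
    "('k \<Rightarrow> 'a \<Rightarrow> 'a) \<Rightarrow> ('k \<Rightarrow> 'b \<Rightarrow> 'b) \<Rightarrow> ('k \<Rightarrow> 'c \<Rightarrow> 'c) \<Rightarrow>
      'a::plus set \<Rightarrow> 'b::plus set \<Rightarrow> 'c::plus set \<Rightarrow> ('a \<Rightarrow> 'b \<Rightarrow> 'c) \<Rightarrow> bool"
  where "bilinear_on s1 s2 s3 A B C g \<longleftrightarrow>
    (\<forall>x\<in>A. linear_on s2 s3 B C (g x)) \<and>
    (\<forall>y\<in>B. linear_on s1 s3 A C (\<lambda>x. g x y))"

definition direct_sum_of :: "'e::monoid_add set \<Rightarrow> 'e set \<Rightarrow> 'e set \<Rightarrow> bool"
  where "direct_sum_of U A B \<longleftrightarrow> U = {a + x |a x. a \<in> A \<and> x \<in> B} \<and> A \<inter> B = {0}"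


section \<open>Rota-Baxter family Hom-associative algebras\<close>

record ('s, 'v) rbfh =
  carr :: "'v set"
  mul :: "'v \<Rightarrow> 'v \<Rightarrow> 'v"
  rb :: "'s \<Rightarrow> 'v \<Rightarrow> 'v"
  twist :: "'v \<Rightarrow> 'v"

locale rbfh_algebra = vector_space sc
  for sc :: "'k::field \<Rightarrow> 'v::ab_group_add \<Rightarrow> 'v" +
  fixes lam :: 'k
    and A :: "('s::semigroup_mult, 'v) rbfh"
  assumes subspace_carr: "subspace (carr A)"
    and bilinear_mul: "bilinear_on sc sc sc (carr A) (carr A) (carr A) (mul A)"
    and linear_rb: "linear_on sc sc (carr A) (carr A) (rb A w)"
    and linear_twist: "linear_on sc sc (carr A) (carr A) (twist A)"
    and hom_assoc: "\<lbrakk>x \<in> carr A; y \<in> carr A; z \<in> carr A\<rbrakk> \<Longrightarrow>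
      mul A (twist A x) (mul A y z) = mul A (mul A x y) (twist A z)"
    and rota_baxter: "\<lbrakk>x \<in> carr A; y \<in> carr A\<rbrakk> \<Longrightarrow>
      mul A (rb A u x) (rb A v y) =
        rb A (u * v) (mul A (rb A u x) y + mul A x (rb A v y) + sc lam (mul A x y))"
    and rb_twist: "x \<in> carr A \<Longrightarrow> rb A w (twist A x) = twist A (rb A w x)"

definition rbfh_subalgebra ::
    "('k::field \<Rightarrow> 'v::ab_group_add \<Rightarrow> 'v) \<Rightarrow> 'k \<Rightarrow>
      ('s::semigroup_mult, 'v) rbfh \<Rightarrow> ('s, 'v) rbfh \<Rightarrow> bool"
  where "rbfh_subalgebra sc lam A E \<longleftrightarrow>
    rbfh_algebra sc lam E \<and> rbfh_algebra sc lam A \<and>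
    carr A \<subseteq> carr E \<and>
    (\<forall>x\<in>carr A. \<forall>y\<in>carr A. mul A x y = mul E x y) \<and>
    (\<forall>w. \<forall>x\<in>carr A. rb A w x = rb E w x) \<and>
    (\<forall>x\<in>carr A. twist A x = twist E x)"

abbreviation rbfh_extension ::
    "('k::field \<Rightarrow> 'v::ab_group_add \<Rightarrow> 'v) \<Rightarrow> 'k \<Rightarrow>
      ('s::semigroup_mult, 'v) rbfh \<Rightarrow> ('s, 'v) rbfh \<Rightarrow> bool"
  where "rbfh_extension sc lam R E \<equiv> rbfh_subalgebra sc lam R E"

definition factorizes_through ::
    "('k::field \<Rightarrow> 'v::ab_group_add \<Rightarrow> 'v) \<Rightarrow> 'k \<Rightarrow>
      ('s::semigroup_mult, 'v) rbfh \<Rightarrow> ('s, 'v) rbfh \<Rightarrow> ('s, 'v) rbfh \<Rightarrow> bool"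
  where "factorizes_through sc lam E R V \<longleftrightarrow>
    rbfh_subalgebra sc lam R E \<and> rbfh_subalgebra sc lam V E \<and>
    direct_sum_of (carr E) (carr R) (carr V)"


section \<open>Extending data and unified products\<close>

text \<open>The four action-like components are named after the arrow and the spaces involved:
  \<open>ltri\<close>, \<open>rtri\<close> are the triangles with values in \<open>W\<close>, and \<open>rharp\<close>, \<open>lharp\<close> the harpoons with
  values in \<open>R\<close>; \<open>ltri\<close> and \<open>lharp\<close> take the element of \<open>R\<close> first.\<close>

record ('s, 'r, 'w) ext_datum =
  ltri :: "'r \<Rightarrow> 'w \<Rightarrow> 'w"    (* a \<triangleright> x *)
  rtri :: "'w \<Rightarrow> 'r \<Rightarrow> 'w"    (* x \<triangleleft> a *)
  rharp :: "'w \<Rightarrow> 'r \<Rightarrow> 'r"   (* x \<rightharpoonup> a *)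
  lharp :: "'r \<Rightarrow> 'w \<Rightarrow> 'r"   (* a \<leftharpoonup> x *)
  cocyc :: "'w \<Rightarrow> 'w \<Rightarrow> 'r"   (* f *)
  mulW :: "'w \<Rightarrow> 'w \<Rightarrow> 'w"
  rbQ :: "'s \<Rightarrow> 'w \<Rightarrow> 'r"
  rbW :: "'s \<Rightarrow> 'w \<Rightarrow> 'w"
  twistR :: "'w \<Rightarrow> 'r"        (* \<eta> *)
  twistW :: "'w \<Rightarrow> 'w"

definition extending_datum ::
    "('k::field \<Rightarrow> 'r::ab_group_add \<Rightarrow> 'r) \<Rightarrow> ('k \<Rightarrow> 'w::ab_group_add \<Rightarrow> 'w) \<Rightarrow> 'k \<Rightarrow>
      ('s::semigroup_mult, 'r) rbfh \<Rightarrow> 'w set \<Rightarrow> ('s, 'r, 'w) ext_datum \<Rightarrow> bool"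
  where "extending_datum sR sW lam R W D \<longleftrightarrow>
    rbfh_algebra sR lam R \<and> vector_space sW \<and> module.subspace sW W \<and>
    bilinear_on sR sW sW (carr R) W W (ltri D) \<and>
    bilinear_on sW sR sW W (carr R) W (rtri D) \<and>
    bilinear_on sW sR sR W (carr R) (carr R) (rharp D) \<and>
    bilinear_on sR sW sR (carr R) W (carr R) (lharp D) \<and>
    bilinear_on sW sW sR W W (carr R) (cocyc D) \<and>
    bilinear_on sW sW sW W W W (mulW D) \<and>
    (\<forall>w. linear_on sW sR W (carr R) (rbQ D w)) \<and>
    (\<forall>w. linear_on sW sW W W (rbW D w)) \<and>
    linear_on sW sR W (carr R) (twistR D) \<and>
    linear_on sW sW W W (twistW D)"

definition unified_product ::
    "('s, 'r::plus) rbfh \<Rightarrow> 'w::plus set \<Rightarrow> ('s, 'r, 'w) ext_datum \<Rightarrow> ('s, 'r \<times> 'w) rbfh"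
  where "unified_product R W D = \<lparr>
    carr = carr R \<times> W,
    mul = (\<lambda>(a, x) (b, y).
      (mul R a b + lharp D a y + rharp D x b + cocyc D x y,
       ltri D a y + rtri D x b + mulW D x y)),
    rb = (\<lambda>w (a, x). (rb R w a + rbQ D w x, rbW D w x)),
    twist = (\<lambda>(a, x). (twist R a + twistR D x, twistW D x))\<rparr>"

definition extending_structure ::
    "('k::field \<Rightarrow> 'r::ab_group_add \<Rightarrow> 'r) \<Rightarrow> ('k \<Rightarrow> 'w::ab_group_add \<Rightarrow> 'w) \<Rightarrow> 'k \<Rightarrow>
      ('s::semigroup_mult, 'r) rbfh \<Rightarrow> 'w set \<Rightarrow> ('s, 'r, 'w) ext_datum \<Rightarrow> bool"
  where "extending_structure sR sW lam R W D \<longleftrightarrow>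
    extending_datum sR sW lam R W D \<and>
    rbfh_algebra (module_prod.scale sR sW) lam (unified_product R W D)"

text \<open>Being a bicrossed product is a property of a unified product together with the extending
  structure it comes from, so it is stated as a predicate on the latter.\<close>

definition unified_product_is_bicrossed ::
    "('k::field \<Rightarrow> 'r::ab_group_add \<Rightarrow> 'r) \<Rightarrow> ('k \<Rightarrow> 'v::ab_group_add \<Rightarrow> 'v) \<Rightarrow> 'k \<Rightarrow>
      ('s::semigroup_mult, 'r) rbfh \<Rightarrow> ('s, 'v) rbfh \<Rightarrow> ('s, 'r, 'v) ext_datum \<Rightarrow> bool"
  where "unified_product_is_bicrossed sR sV lam R V D \<longleftrightarrow>
    rbfh_algebra sR lam R \<and> rbfh_algebra sV lam V \<and>
    extending_structure sR sV lam R (carr V) D \<and>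
    (\<forall>x\<in>carr V. \<forall>y\<in>carr V. cocyc D x y = 0) \<and>
    (\<forall>w. \<forall>x\<in>carr V. rbQ D w x = 0) \<and>
    (\<forall>x\<in>carr V. twistR D x = 0) \<and>
    (\<forall>x\<in>carr V. \<forall>y\<in>carr V. mulW D x y = mul V x y) \<and>
    (\<forall>w. \<forall>x\<in>carr V. rbW D w x = rb V w x) \<and>
    (\<forall>x\<in>carr V. twistW D x = twist V x)"

definition is_retraction ::
    "'e::plus set \<Rightarrow> 'e set \<Rightarrow> ('e \<Rightarrow> 'e) \<Rightarrow> bool"
  where "is_retraction R V \<rho> \<longleftrightarrow> (\<forall>a\<in>R. \<forall>x\<in>V. \<rho> (a + x) = a)"

definition Upsilon1 ::
    "('s, 'e::minus) rbfh \<Rightarrow> ('e \<Rightarrow> 'e) \<Rightarrow> ('s, 'e, 'e) ext_datum"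
  where "Upsilon1 E \<rho> = \<lparr>
    ltri = (\<lambda>a x. mul E a x - \<rho> (mul E a x)),
    rtri = (\<lambda>x a. mul E x a - \<rho> (mul E x a)),
    rharp = (\<lambda>x a. \<rho> (mul E x a)),
    lharp = (\<lambda>a x. \<rho> (mul E a x)),
    cocyc = (\<lambda>x y. \<rho> (mul E x y)),
    mulW = (\<lambda>x y. mul E x y - \<rho> (mul E x y)),
    rbQ = (\<lambda>w x. \<rho> (rb E w x)),
    rbW = (\<lambda>w x. rb E w x - \<rho> (rb E w x)),
    twistR = (\<lambda>x. \<rho> (twist E x)),
    twistW = (\<lambda>x. twist E x - \<rho> (twist E x))\<rparr>"

end

theory Submission
  imports Defs
begin

text \<open>The map \<open>(a, x) \<mapsto> a + x\<close> is a linear bijection from \<open>R \<times> V\<close> onto \<open>E\<close> that carries the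
  operations of the unified product of \<open>\<Upsilon>\<^sub>1(E)\<close> to those of \<open>E\<close>, so the axioms for \<open>E\<close> pull back
  and \<open>\<Upsilon>\<^sub>1(E)\<close> is an extending structure whether or not \<open>V\<close> is a subalgebra. The latter holds
  iff \<open>E\<close>'s operations on \<open>V\<close> are those of \<open>V\<close>; as \<open>\<rho>\<close> vanishes exactly on \<open>V\<close>, this says that
  \<open>f\<close>, \<open>Q\<^sub>\<omega>\<close>, \<open>\<eta>\<close> vanish and the remaining components on \<open>V\<close> are the given ones.\<close>

lemma linear_onI:
  assumes "\<And>x. x \<in> A \<Longrightarrow> f x \<in> B"
    and "\<And>x y. x \<in> A \<Longrightarrow> y \<in> A \<Longrightarrow> f (x + y) = f x + f y"
    and "\<And>c x. x \<in> A \<Longrightarrow> f (s1 c x) = s2 c (f x)"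
  shows "linear_on s1 s2 A B f"
  using assms by (simp add: linear_on_def)

lemma linear_onD:
  assumes "linear_on s1 s2 A B f" "x \<in> A"
  shows "f x \<in> B"
    and "y \<in> A \<Longrightarrow> f (x + y) = f x + f y"
    and "f (s1 c x) = s2 c (f x)"
  using assms by (simp_all add: linear_on_def)

lemma linear_on_compose:
  assumes "linear_on s1 s2 A B f" "linear_on s2 s3 B C g"
  shows "linear_on s1 s3 A C (\<lambda>x. g (f x))"
  using assms by (simp add: linear_on_def)

lemma linear_on_subset:
  assumes "linear_on s1 s2 A B f" "A' \<subseteq> A"
  shows "linear_on s1 s2 A' B f"
  using assms by (auto simp: linear_on_def subset_iff)

lemma bilinear_on_compose:
  assumes "bilinear_on s1 s2 s3 A B C g" "linear_on s3 s4 C D h"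
  shows "bilinear_on s1 s2 s4 A B D (\<lambda>x y. h (g x y))"
  using assms
  by (auto simp: bilinear_on_def intro: linear_on_compose)

lemma bilinear_on_subset:
  assumes "bilinear_on s1 s2 s3 A B C g" "A' \<subseteq> A" "B' \<subseteq> B"
  shows "bilinear_on s1 s2 s3 A' B' C g"
  using assms unfolding bilinear_on_def by (blast intro: linear_on_subset)

lemma bilinear_onD:
  assumes "bilinear_on s1 s2 s3 A B C g" "x \<in> A" "y \<in> B"
  shows "g x y \<in> C"
    and "x' \<in> A \<Longrightarrow> g (x + x') y = g x y + g x' y"
    and "y' \<in> B \<Longrightarrow> g x (y + y') = g x y + g x y'"
    and "g (s1 c x) y = s3 c (g x y)"
    and "g x (s2 c y) = s3 c (g x y)"
  using assms by (simp_all add: bilinear_on_def linear_on_def)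

text \<open>Injectivity of \<open>\<phi>\<close> lets each linearity identity for \<open>f\<close>
  be tested after applying \<open>\<phi>\<close>, where it becomes the same identity for
  \<open>g\<close>. The premise \<open>closed\<close> puts both sides in \<open>A\<close>, as
  injectivity on \<open>A\<close> requires.\<close>

lemma linear_on_pullback:
  assumes A: "module.subspace s1 A" "module s1"
    and \<phi>: "linear_on s1 s2 A E \<phi>" "inj_on \<phi> A"
    and g: "linear_on s2 s2 E E g"
    and closed: "\<And>x. x \<in> A \<Longrightarrow> f x \<in> A"
    and hom: "\<And>x. x \<in> A \<Longrightarrow> \<phi> (f x) = g (\<phi> x)"
  shows "linear_on s1 s1 A A f"
proof -
  note sub = module.subspace_add[OF A(2,1)] module.subspace_scale[OF A(2,1)]
  \<comment> \<open>The \<open>?\<close> lets the membership goal, which is not an equation, pass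
    unchanged to the simplifier.\<close>
  show ?thesis
    by (rule linear_onI; (rule inj_onD[OF \<phi>(2)])?)
      (simp_all add: sub closed hom linear_onD[OF \<phi>(1)] linear_onD[OF g])
qed

text \<open>Apart from linearity and closure, the axioms are universally quantified equations. An
  injective linear map that intertwines the operations therefore reflects them from \<open>E\<close>
  to \<open>A\<close>.\<close>

lemma rbfh_algebra_pullback:
  fixes A :: "('s::semigroup_mult, 'a::ab_group_add) rbfh"
    and E :: "('s, 'e::ab_group_add) rbfh"
  assumes E: "rbfh_algebra s2 lam E"
    and A: "vector_space s1" "module.subspace s1 (carr A)"
    and \<phi>: "linear_on s1 s2 (carr A) (carr E) \<phi>" "inj_on \<phi> (carr A)"
    and closed: "\<And>x y. x \<in> carr A \<Longrightarrow> y \<in> carr A \<Longrightarrow> mul A x y \<in> carr A"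
      "\<And>w x. x \<in> carr A \<Longrightarrow> rb A w x \<in> carr A"
      "\<And>x. x \<in> carr A \<Longrightarrow> twist A x \<in> carr A"
    and hom: "\<And>x y. x \<in> carr A \<Longrightarrow> y \<in> carr A \<Longrightarrow> \<phi> (mul A x y) = mul E (\<phi> x) (\<phi> y)"
      "\<And>w x. x \<in> carr A \<Longrightarrow> \<phi> (rb A w x) = rb E w (\<phi> x)"
      "\<And>x. x \<in> carr A \<Longrightarrow> \<phi> (twist A x) = twist E (\<phi> x)"
  shows "rbfh_algebra s1 lam A"
proof -
  interpret E: rbfh_algebra s2 lam E by (rule E)
  interpret A: vector_space s1 by (rule A)
  note sub = A.subspace_add[OF A(2)] A.subspace_scale[OF A(2)]
  note \<phi>_simps = linear_onD[OF \<phi>(1)]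
  note pullback = linear_on_pullback[OF A(2) A.module_axioms \<phi>]
  \<comment> \<open>Fixing one factor reduces bilinearity to \<open>linear_on_pullback\<close>, with
    the fixed factor \<open>x\<close> sent to \<open>\<phi> x\<close>.\<close>
  have mul_lin: "linear_on s2 s2 (carr E) (carr E) (mul E u)"
    "linear_on s2 s2 (carr E) (carr E) (\<lambda>v. mul E v u)" if "u \<in> carr E" for u
    using E.bilinear_mul that by (simp_all add: bilinear_on_def)
  show ?thesis
  proof
    show "A.subspace (carr A)" by (rule A)
    show "bilinear_on s1 s1 s1 (carr A) (carr A) (carr A) (mul A)"
      unfolding bilinear_on_def
    proof (intro conjI ballI)
      fix x assume x: "x \<in> carr A"
      show "linear_on s1 s1 (carr A) (carr A) (mul A x)"
        by (rule pullback[OF mul_lin(1)[of "\<phi> x"]]) (simp_all add: x closed hom \<phi>_simps)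
      show "linear_on s1 s1 (carr A) (carr A) (\<lambda>v. mul A v x)"
        by (rule pullback[OF mul_lin(2)[of "\<phi> x"]]) (simp_all add: x closed hom \<phi>_simps)
    qed
    show "linear_on s1 s1 (carr A) (carr A) (rb A w)" for w
      by (rule pullback[OF E.linear_rb]) (simp_all add: closed hom)
    show "linear_on s1 s1 (carr A) (carr A) (twist A)"
      by (rule pullback[OF E.linear_twist]) (simp_all add: closed hom)
    show "mul A (twist A x) (mul A y z) = mul A (mul A x y) (twist A z)"
      if "x \<in> carr A" "y \<in> carr A" "z \<in> carr A" for x y z
      by (rule inj_onD[OF \<phi>(2)]) (simp_all add: that closed hom \<phi>_simps E.hom_assoc)
    show "mul A (rb A u x) (rb A v y) =
        rb A (u * v) (mul A (rb A u x) y + mul A x (rb A v y) + s1 lam (mul A x y))"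
      if "x \<in> carr A" "y \<in> carr A" for u v x y
      by (rule inj_onD[OF \<phi>(2)])
        (simp_all add: that closed hom sub \<phi>_simps E.rota_baxter)
    show "rb A w (twist A x) = twist A (rb A w x)" if "x \<in> carr A" for w x
      by (rule inj_onD[OF \<phi>(2)]) (simp_all add: that closed hom \<phi>_simps E.rb_twist)
  qed
qed

text \<open>Pure linear algebra of the decomposition: \<open>U\<close>, \<open>A\<close>,
  \<open>B\<close> will be the carriers of \<open>E\<close>, \<open>R\<close>, \<open>V\<close>.
  Since \<open>\<rho>\<close> is total, only its values on \<open>U\<close> are determined.\<close>

locale direct_sum_retraction = vector_space sc
  for sc :: "'k::field \<Rightarrow> 'e::ab_group_add \<Rightarrow> 'e" +
  fixes U A B :: "'e set" and \<rho> :: "'e \<Rightarrow> 'e"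
  assumes subspace_A: "subspace A" and subspace_B: "subspace B"
    and direct_sum: "direct_sum_of U A B"
    and retraction: "is_retraction A B \<rho>"
begin

lemma rho_add: "a \<in> A \<Longrightarrow> x \<in> B \<Longrightarrow> \<rho> (a + x) = a"
  using retraction by (simp add: is_retraction_def)

lemma decompose:
  assumes "u \<in> U"
  obtains a x where "a \<in> A" "x \<in> B" "u = a + x"
  using assms direct_sum by (auto simp: direct_sum_of_def)

lemma add_mem: "a \<in> A \<Longrightarrow> x \<in> B \<Longrightarrow> a + x \<in> U"
  using direct_sum by (auto simp: direct_sum_of_def)

lemma subsets: "A \<subseteq> U" "B \<subseteq> U"
  using add_mem[OF _ subspace_0[OF subspace_B]] add_mem[OF subspace_0[OF subspace_A]] by auto

lemma rho_eq_0: "x \<in> B \<Longrightarrow> \<rho> x = 0"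
  using rho_add[OF subspace_0[OF subspace_A]] by simp

lemma linear_rho: "linear_on sc sc U A \<rho>"
proof (rule linear_onI)
  fix u v assume "u \<in> U" "v \<in> U"
  then obtain a x b y where "a \<in> A" "x \<in> B" "u = a + x" "b \<in> A" "y \<in> B" "v = b + y"
    by (meson decompose)
  moreover have "\<rho> ((a + b) + (x + y)) = a + b"
    using calculation by (intro rho_add subspace_add subspace_A subspace_B)
  ultimately show "\<rho> (u + v) = \<rho> u + \<rho> v"
    by (simp add: rho_add algebra_simps)
next
  fix c u assume "u \<in> U"
  then show "\<rho> (sc c u) = sc c (\<rho> u)"
    by (auto elim!: decompose
      simp: rho_add scale_right_distrib subspace_scale subspace_A subspace_B)
qed (auto elim!: decompose simp: rho_add)

text \<open>This is the other projection of the direct sum, onto \<open>B\<close> along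
  \<open>A\<close>.\<close>

lemma linear_complement: "linear_on sc sc U B (\<lambda>u. u - \<rho> u)"
proof (rule linear_onI)
  show "u - \<rho> u \<in> B" if "u \<in> U" for u
    using that by (auto elim!: decompose simp: rho_add)
qed (simp_all add: linear_onD[OF linear_rho] scale_right_diff_distrib)

text \<open>Applying \<open>\<rho>\<close> to a sum recovers its \<open>A\<close>-component;
  cancellation then gives the other one.\<close>

lemma inj_on_add: "inj_on (\<lambda>(a, x). a + x) (A \<times> B)"
proof (rule inj_onI, clarify)
  fix a x b y assume "a \<in> A" "x \<in> B" "b \<in> A" "y \<in> B" "a + x = b + y"
  moreover from this have "a = b" by (metis rho_add)
  ultimately show "a = b \<and> x = y" by simp
qed

lemma extending_structure_Upsilon1:
  fixes R E :: "('s::semigroup_mult, 'e) rbfh"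
  assumes R: "rbfh_subalgebra sc lam R E" and carr: "carr E = U" "carr R = A"
  shows "extending_structure sc sc lam R B (Upsilon1 E \<rho>)"
proof -
  interpret E: rbfh_algebra sc lam E using R by (simp add: rbfh_subalgebra_def)
  interpret R: rbfh_algebra sc lam R using R by (simp add: rbfh_subalgebra_def)
  interpret P: vector_space_prod sc sc ..
  have R_eq: "mul R a b = mul E a b" "rb R w a = rb E w a" "twist R a = twist E a"
    if "a \<in> A" "b \<in> A" for a b w
    using R that carr by (simp_all add: rbfh_subalgebra_def)
  have mul_E: "bilinear_on sc sc sc U U U (mul E)"
    and lin_E: "linear_on sc sc U U (rb E w)" "linear_on sc sc U U (twist E)" for w
    using E.bilinear_mul E.linear_rb E.linear_twist by (simp_all add: carr)
  \<comment> \<open>Each component of \<open>Upsilon1\<close> is an operation of \<open>E\<close>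
    followed by one of the two projections, which gives its linearity and its target.
    \<open>X\<close> and \<open>Y\<close> range over the choices of \<open>A\<close> and
    \<open>B\<close> as factors.\<close>
  have mul_ER: "bilinear_on sc sc sc X Y A (\<lambda>x y. \<rho> (mul E x y))"
    and mul_EB: "bilinear_on sc sc sc X Y B (\<lambda>x y. mul E x y - \<rho> (mul E x y))"
    if "X \<subseteq> U" "Y \<subseteq> U" for X Y
    by (rule bilinear_on_compose[OF bilinear_on_subset[OF mul_E that] linear_rho]
      bilinear_on_compose[OF bilinear_on_subset[OF mul_E that] linear_complement])+
  have lin_ER: "linear_on sc sc B A (\<lambda>x. \<rho> (g x))"
    and lin_EB: "linear_on sc sc B B (\<lambda>x. g x - \<rho> (g x))"
    if "linear_on sc sc U U g" for g
    by (rule linear_on_compose[OF linear_on_subset[OF that subsets(2)] linear_rho]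
      linear_on_compose[OF linear_on_subset[OF that subsets(2)] linear_complement])+
  have datum: "extending_datum sc sc lam R B (Upsilon1 E \<rho>)"
    unfolding extending_datum_def Upsilon1_def
    by (simp add: R.rbfh_algebra_axioms vector_space_axioms subspace_B carr
      mul_ER mul_EB lin_ER lin_EB lin_E subsets)
  have mem: "a \<in> U" if "a \<in> A \<or> a \<in> B" for a
    using that subsets by auto
  let ?P = "unified_product R B (Upsilon1 E \<rho>)"
  note defs = unified_product_def Upsilon1_def
  note E_simps = bilinear_onD[OF mul_E] linear_onD[OF lin_E(1)] linear_onD[OF lin_E(2)]
  \<comment> \<open>Closure of \<open>A\<close> is phrased with the operations of \<open>E\<close>
    because \<open>R_eq\<close> rewrites those of \<open>R\<close> into them.\<close>
  have R_closed: "mul E a b \<in> A" "rb E w a \<in> A" "twist E a \<in> A" if "a \<in> A" "b \<in> A" for a b w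
    using that bilinear_onD(1)[OF R.bilinear_mul] linear_onD(1)[OF R.linear_rb]
      linear_onD(1)[OF R.linear_twist] by (simp_all add: carr R_eq)
  note closed = R_closed subspace_add[OF subspace_A] subspace_add[OF subspace_B]
    linear_onD(1)[OF linear_rho] linear_onD(1)[OF linear_complement]
  have "rbfh_algebra P.scale lam ?P"
  proof (rule rbfh_algebra_pullback[OF E.rbfh_algebra_axioms, where \<phi> = "\<lambda>(a, x). a + x"])
    show "vector_space P.scale" by (rule P.p.vector_space_axioms)
    show "P.p.subspace (carr ?P)"
      by (simp add: unified_product_def carr P.subspace_Times subspace_A subspace_B)
    show "linear_on P.scale sc (carr ?P) (carr E) (\<lambda>(a, x). a + x)"
      by (rule linear_onI)
        (auto simp: unified_product_def carr add_mem P.scale_def scale_right_distrib)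
    show "inj_on (\<lambda>(a, x). a + x) (carr ?P)"
      using inj_on_add by (simp add: unified_product_def carr)
  \<comment> \<open>For the intertwining goals, the two components add up by
    \<open>\<rho> u + (u - \<rho> u) = u\<close>. For the product this leaves
    \<open>ab + ay + xb + xy\<close>, which is \<open>(a + x)(b + y)\<close> computed in
    \<open>E\<close>.\<close>
  qed (auto simp: defs carr E_simps R_eq mem add_mem closed add_ac)
  with datum show ?thesis by (simp add: extending_structure_def)
qed

end

theorem proposition3p18:
  fixes sc :: "'k::field \<Rightarrow> 'e::ab_group_add \<Rightarrow> 'e"
    and lam :: 'k
    and R V E :: "('s::semigroup_mult, 'e) rbfh"
    and \<rho> :: "'e \<Rightarrow> 'e"
  assumes "rbfh_algebra sc lam R"
    and "rbfh_algebra sc lam V"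
    and "direct_sum_of (carr E) (carr R) (carr V)"
    and "is_retraction (carr R) (carr V) \<rho>"
    and "rbfh_extension sc lam R E"
  shows "factorizes_through sc lam E R V \<longleftrightarrow>
    unified_product_is_bicrossed sc sc lam R V (Upsilon1 E \<rho>)"
proof -
  interpret R: rbfh_algebra sc lam R by fact
  interpret V: rbfh_algebra sc lam V by fact
  interpret direct_sum_retraction sc "carr E" "carr R" "carr V" \<rho>
    using assms R.subspace_carr V.subspace_carr by unfold_locales
  have E: "rbfh_algebra sc lam E"
    using assms(5) by (simp add: rbfh_subalgebra_def)
  \<comment> \<open>A vanishing \<open>R\<close>-component and a prescribed
    \<open>V\<close>-component \<open>v\<close> merge into a single equation. From right to left,
    \<open>u = v\<close> lies in \<open>V\<close>, so \<open>\<rho>\<close> kills it.\<close>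
  have Upsilon1_iff: "\<rho> u = 0 \<and> u - \<rho> u = v \<longleftrightarrow> v = u" if "v \<in> carr V" for u v
    using that rho_eq_0 by auto
  have V_closed: "mul V x y \<in> carr V" "rb V w x \<in> carr V" "twist V x \<in> carr V"
    if "x \<in> carr V" "y \<in> carr V" for x y w
    using that bilinear_onD(1)[OF V.bilinear_mul] linear_onD(1)[OF V.linear_rb]
      linear_onD(1)[OF V.linear_twist] by auto
  \<comment> \<open>The extending structure condition always holds here, so only equations remain.
    They are grouped in pairs to match \<open>Upsilon1_iff\<close>: \<open>cocyc\<close> with
    \<open>mulW\<close>, \<open>rbQ\<close> with \<open>rbW\<close>, \<open>twistR\<close> with
    \<open>twistW\<close>.\<close>
  have "unified_product_is_bicrossed sc sc lam R V (Upsilon1 E \<rho>) \<longleftrightarrow>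
    (\<forall>x\<in>carr V. \<forall>y\<in>carr V. \<rho> (mul E x y) = 0 \<and> mul E x y - \<rho> (mul E x y) = mul V x y) \<and>
    (\<forall>w. \<forall>x\<in>carr V. \<rho> (rb E w x) = 0 \<and> rb E w x - \<rho> (rb E w x) = rb V w x) \<and>
    (\<forall>x\<in>carr V. \<rho> (twist E x) = 0 \<and> twist E x - \<rho> (twist E x) = twist V x)"
    using assms extending_structure_Upsilon1[OF assms(5) refl refl]
    by (auto simp: unified_product_is_bicrossed_def Upsilon1_def)
  also have "\<dots> \<longleftrightarrow> (\<forall>x\<in>carr V. \<forall>y\<in>carr V. mul V x y = mul E x y) \<and>
    (\<forall>w. \<forall>x\<in>carr V. rb V w x = rb E w x) \<and> (\<forall>x\<in>carr V. twist V x = twist E x)"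
    by (simp add: Upsilon1_iff V_closed)
  \<comment> \<open>The hypotheses and \<open>subsets\<close> supply everything in the factorization
    except the agreement of operations on \<open>V\<close>.\<close>
  also have "\<dots> \<longleftrightarrow> factorizes_through sc lam E R V"
    using assms E subsets by (simp add: factorizes_through_def rbfh_subalgebra_def)
  finally show ?thesis by simp
qed

end
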